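(* Let $d\ge 1$ and let $Y$ be a finite $\mathbb Z^d$-subshift. Then the problem "$Y\hookrightarrow X$ for SFT inputs $X$" is decidable.
   Context: For a finite alphabet $\mathcal A$, $\mathbb Z^d$ acts on $\mathcal A^{\mathbb Z^d}$ by $\sigma^u(x)(v)=x(v+u)$. A pattern is a function $p\colon S\to\mathcal A$ with $S\subset\mathbb Z^d$ finite; it appears in $x$ if $\sigma^u(x)|_S=p$ for some $u$. A subshift is a (possibly empty) topologically closed, shift-invariant subset of $\mathcal A^{\mathbb Z^d}$ (finite means finite as a set of configurations); it is an SFT if it is the set of configurations in which no pattern from some finite set $\mathcal F$ appears. $Y\hookrightarrow X$ means there is an embedding, i.e. a continuous, shift-commuting, injective map $Y\to X$. The subshift $Y$ is a fixed parameter. "The problem $Y\hookrightarrow X$ for SFT inputs" is: given a $\mathbb Z^d$-SFT $X$, specified by an alphabet and a finite set of forbidden patterns, determine whether $Y\hookrightarrow X$. *)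

theory Defs
  imports "HOL-Analysis.Analysis" "HOL-Library.Nat_Bijection"
begin

section \<open>Subshifts over \<open>int ^ 'd\<close>\<close>

type_synonym ('d, 'a) config = "(int ^ 'd) \<Rightarrow> 'a"
type_synonym ('d, 'a) pattern = "(int ^ 'd) \<rightharpoonup> 'a"

definition shift :: "int ^ 'd \<Rightarrow> ('d::finite, 'a) config \<Rightarrow> ('d, 'a) config"
  where "shift u x = (\<lambda>v. x (v + u))"

definition full_shift :: "'a set \<Rightarrow> ('d::finite, 'a) config topology"
  where "full_shift A = product_topology (\<lambda>_. discrete_topology A) UNIV"

lemma topspace_full_shift: "topspace (full_shift A) = {x. \<forall>v. x v \<in> A}"
  by (auto simp: full_shift_def)

definition subshift :: "'a set \<Rightarrow> ('d::finite, 'a) config set \<Rightarrow> bool"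
  where "subshift A X \<longleftrightarrow> closedin (full_shift A) X \<and> (\<forall>u. \<forall>x\<in>X. shift u x \<in> X)"

definition appears :: "('d::finite, 'a) pattern \<Rightarrow> ('d, 'a) config \<Rightarrow> bool"
  where "appears p x \<longleftrightarrow> (\<exists>u. \<forall>v\<in>dom p. p v = Some (shift u x v))"

text \<open>\<open>SFT A F\<close> is a subshift of finite type whenever \<open>F\<close> is a finite set of patterns with
  finite domains.\<close>

definition SFT :: "'a set \<Rightarrow> ('d::finite, 'a) pattern set \<Rightarrow> ('d, 'a) config set"
  where "SFT A F = {x \<in> topspace (full_shift A). \<forall>p\<in>F. \<not> appears p x}"

definition embeds ::
    "'a set \<Rightarrow> ('d::finite, 'a) config set \<Rightarrow> 'b set \<Rightarrow> ('d, 'b) config set \<Rightarrow> bool"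
  where "embeds A Y B X \<longleftrightarrow>
    (\<exists>\<phi>. continuous_map (subtopology (full_shift A) Y) (subtopology (full_shift B) X) \<phi>
       \<and> (\<forall>u. \<forall>y\<in>Y. \<phi> (shift u y) = shift u (\<phi> y))
       \<and> inj_on \<phi> Y)"


section \<open>Decidability\<close>

text \<open>Partial recursive functions. Arities are not recorded in the terms: \<open>recf_eval f xs y\<close>
  says that \<open>f\<close>, on the argument list \<open>xs\<close>, halts with value \<open>y\<close>.\<close>

datatype recf =
  Zero | Succ | Proj nat | Comp recf "recf list" | PrimRec recf recf | Mu recf

inductive recf_eval :: "recf \<Rightarrow> nat list \<Rightarrow> nat \<Rightarrow> bool" where
  zero: "recf_eval Zero xs 0"
| succ: "recf_eval Succ [x] (Suc x)"
| proj: "i < length xs \<Longrightarrow> recf_eval (Proj i) xs (xs ! i)"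
| comp: "list_all2 (\<lambda>g y. recf_eval g xs y) gs ys \<Longrightarrow> recf_eval f ys z \<Longrightarrow>
    recf_eval (Comp f gs) xs z"
| prec_0: "recf_eval f xs y \<Longrightarrow> recf_eval (PrimRec f g) (0 # xs) y"
| prec_Suc: "recf_eval (PrimRec f g) (n # xs) y \<Longrightarrow> recf_eval g (n # y # xs) z \<Longrightarrow>
    recf_eval (PrimRec f g) (Suc n # xs) z"
| mu: "recf_eval f (n # xs) 0 \<Longrightarrow> (\<forall>m<n. \<exists>y. recf_eval f (m # xs) (Suc y)) \<Longrightarrow>
    recf_eval (Mu f) xs n"

inductive_cases recf_eval_elims:
  "recf_eval Zero xs z"
  "recf_eval Succ xs z"
  "recf_eval (Proj i) xs z"
  "recf_eval (Comp f gs) xs z"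
  "recf_eval (PrimRec f g) (0 # xs) z"
  "recf_eval (PrimRec f g) (Suc n # xs) z"
  "recf_eval (Mu f) xs z"

lemma recf_eval_deterministic: "recf_eval f xs y \<Longrightarrow> recf_eval f xs z \<Longrightarrow> y = z"
proof (induction arbitrary: z rule: recf_eval.induct)
  case (comp xs gs ys f w)
  from comp.prems obtain ys' where
    ys': "list_all2 (\<lambda>g y. recf_eval g xs y) gs ys'" and z: "recf_eval f ys' z"
    by (rule recf_eval_elims)
  have "ys = ys'"
    using comp.IH(1) ys' by (auto simp: list_all2_conv_all_nth intro!: nth_equalityI)
  with z comp.IH(2) show ?case by blast
next
  case (prec_Suc f g n xs y w)
  from prec_Suc.prems obtain y' where
    "recf_eval (PrimRec f g) (n # xs) y'" "recf_eval g (n # y' # xs) z"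
    by (rule recf_eval_elims)
  with prec_Suc.IH show ?case by blast
next
  case (mu f n xs)
  from mu.prems have 0: "recf_eval f (z # xs) 0"
    and 1: "\<forall>m<z. \<exists>y. recf_eval f (m # xs) (Suc y)"
    by (blast elim: recf_eval_elims)+
  have "\<not> n < z" using mu.IH(1) 1 by fastforce
  moreover have "\<not> z < n" using mu.IH(2) 0 by fastforce
  ultimately show ?case by simp
qed (blast elim: recf_eval_elims)+

definition decidable :: "nat set \<Rightarrow> bool"
  where "decidable L \<longleftrightarrow> (\<exists>f. \<forall>n. recf_eval f [n] (if n \<in> L then 1 else 0))"


section \<open>SFT inputs\<close>

text \<open>An input lists the symbols of the alphabet, which are natural numbers, and the forbidden
  patterns, each of them as an association list from positions to symbols.\<close>

type_synonym 'd sft_input = "nat list \<times> ((int ^ 'd) \<times> nat) list list"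

definition input_alphabet :: "'d::finite sft_input \<Rightarrow> nat set"
  where "input_alphabet I = set (fst I)"

definition input_patterns :: "'d::finite sft_input \<Rightarrow> ('d, nat) pattern set"
  where "input_patterns I = map_of ` set (snd I)"

definition valid_input :: "'d::finite sft_input \<Rightarrow> bool"
  where "valid_input I \<longleftrightarrow>
    (\<forall>p\<in>set (snd I). distinct (map fst p) \<and> snd ` set p \<subseteq> input_alphabet I)"

definition input_SFT :: "'d::finite sft_input \<Rightarrow> ('d, nat) config set"
  where "input_SFT I = SFT (input_alphabet I) (input_patterns I)"

text \<open>The valid inputs present exactly the pairs of a finite alphabet of natural numbers and a
  finite set of patterns over it.\<close>

lemma valid_input_presents:
  fixes I :: "'d::finite sft_input"
  assumes "valid_input I"
  shows "finite (input_alphabet I)" "finite (input_patterns I)"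
    "\<forall>p\<in>input_patterns I. finite (dom p) \<and> ran p \<subseteq> input_alphabet I"
  using assms
  by (auto simp: input_alphabet_def input_patterns_def valid_input_def finite_dom_map_of ran_distinct)

lemma ex_valid_input:
  fixes F :: "('d::finite, nat) pattern set"
  assumes "finite A" "finite F" and F: "\<forall>p\<in>F. finite (dom p) \<and> ran p \<subseteq> A"
  shows "\<exists>I. valid_input I \<and> input_alphabet I = A \<and> input_patterns I = F"
proof -
  obtain as where as: "set as = A" using finite_list[OF \<open>finite A\<close>] by blast
  obtain Fs where Fs: "set Fs = F" using finite_list[OF \<open>finite F\<close>] by blast
  have "\<exists>xs. distinct (map fst xs) \<and> map_of xs = p" if "p \<in> F" for p
  proof -
    from F that have "finite (dom p)" by blast
    then obtain vs where vs: "set vs = dom p" "distinct vs" using finite_distinct_list by blast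
    let ?xs = "map (\<lambda>v. (v, the (p v))) vs"
    have "map_of ?xs = p"
      using vs by (auto simp: map_of_map_keys restrict_map_def fun_eq_iff domIff)
    moreover have "distinct (map fst ?xs)" using vs by (simp add: comp_def)
    ultimately show ?thesis by blast
  qed
  then obtain al where al: "distinct (map fst (al p))" "map_of (al p) = p" if "p \<in> F" for p
    by metis
  have "snd ` set (al p) \<subseteq> A" if "p \<in> F" for p
    using F al[OF that] that ran_distinct[of "al p"] by auto
  then have "valid_input (as, map al Fs)"
    using as Fs al by (auto simp: valid_input_def input_alphabet_def)
  moreover have "input_patterns (as, map al Fs) = F"
    using Fs al by (force simp: input_patterns_def)
  ultimately show ?thesis using as by (auto simp: input_alphabet_def)
qed

definition position_code :: "int ^ 'd::finite \<Rightarrow> nat"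
  where "position_code v =
    list_encode (map (\<lambda>j. int_encode (v $ from_nat_into UNIV j)) [0..<CARD('d)])"

definition pattern_code :: "((int ^ 'd::finite) \<times> nat) list \<Rightarrow> nat"
  where "pattern_code p = list_encode (map (\<lambda>(v, a). prod_encode (position_code v, a)) p)"

definition input_code :: "'d::finite sft_input \<Rightarrow> nat"
  where "input_code I = prod_encode (list_encode (fst I), list_encode (map pattern_code (snd I)))"

lemma inj_position_code: "inj (position_code :: int ^ 'd::finite \<Rightarrow> nat)"
proof (rule injI)
  fix v w :: "int ^ 'd"
  assume eq: "position_code v = position_code w"
  have "v $ i = w $ i" for i
  proof -
    have "i \<in> from_nat_into UNIV ` {..<CARD('d)}"
      using bij_betw_from_nat_into_finite[of "UNIV :: 'd set"] by (simp add: bij_betw_def)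
    then show ?thesis
      using eq by (auto simp: position_code_def list_encode_eq int_encode_eq)
  qed
  then show "v = w" by (simp add: vec_eq_iff)
qed

lemma inj_pattern_code: "inj (pattern_code :: ((int ^ 'd::finite) \<times> nat) list \<Rightarrow> nat)"
proof -
  have "inj (\<lambda>(v :: int ^ 'd, a). prod_encode (position_code v, a))"
    using inj_position_code by (auto simp: inj_def)
  then show ?thesis
    by (auto intro!: injI simp: pattern_code_def list_encode_eq dest: map_injective)
qed

lemma inj_input_code: "inj (input_code :: 'd::finite sft_input \<Rightarrow> nat)"
  by (auto intro!: injI simp: input_code_def list_encode_eq inj_map_eq_map[OF inj_pattern_code]
      intro: prod_eqI)

text \<open>The problem ``Y embeds into X, for SFT inputs X'', as the set of the codes of its
  yes-instances.\<close>

definition embedding_problem :: "'a set \<Rightarrow> ('d::finite, 'a) config set \<Rightarrow> nat set"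
  where "embedding_problem A Y =
    {input_code I |I :: 'd sft_input.
       valid_input I \<and> embeds A Y (input_alphabet I) (input_SFT I)}"

end

theory Submission
  imports Defs
begin

text \<open>An equivariant map \<open>\<phi>\<close> from \<open>Y\<close> has the form \<open>\<phi> y v = g (shift v y)\<close> for the block map
  \<open>g y = \<phi> y 0\<close>, and every function \<open>g\<close> on \<open>Y\<close> arises, since continuity is automatic on a finite
  subshift. So an embedding amounts to one of finitely many functions from \<open>Y\<close> to the alphabet, and
  it remains to test its injectivity and the forbidden patterns at the origin of each configuration.
  All configurations of \<open>Y\<close> share a period \<open>N\<close>, whence \<open>shift v y\<close> is found by looking up \<open>v\<close> modulo
  \<open>N\<close> in a finite table, and both tests become bounded quantifications over lists.\<close>

section \<open>Recursive functions\<close>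

text \<open>The length \<open>k\<close> stands in for the arity that terms do not record. A value is
  demanded on every list of that length, so only total functions qualify.\<close>

definition recursive :: "nat \<Rightarrow> (nat list \<Rightarrow> nat) \<Rightarrow> bool"
  where "recursive k F \<longleftrightarrow> (\<exists>f. \<forall>xs. length xs = k \<longrightarrow> recf_eval f xs (F xs))"

lemma recursive_cong:
  assumes "recursive k F" and "\<And>xs. length xs = k \<Longrightarrow> F xs = G xs"
  shows "recursive k G"
  using assms unfolding recursive_def by metis

lemma recursive_nth: "i < k \<Longrightarrow> recursive k (\<lambda>xs. xs ! i)"
  unfolding recursive_def by (metis recf_eval.proj)

lemma recursive_comp:
  assumes F: "recursive (length Gs) F" and Gs: "\<And>G. G \<in> set Gs \<Longrightarrow> recursive k G"
  shows "recursive k (\<lambda>xs. F (map (\<lambda>G. G xs) Gs))"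
proof -
  obtain f where f: "\<And>xs. length xs = length Gs \<Longrightarrow> recf_eval f xs (F xs)"
    using F by (auto simp: recursive_def)
  obtain t where t: "\<And>G xs. \<lbrakk>G \<in> set Gs; length xs = k\<rbrakk> \<Longrightarrow> recf_eval (t G) xs (G xs)"
    using Gs unfolding recursive_def by metis
  have "recf_eval (Comp f (map t Gs)) xs (F (map (\<lambda>G. G xs) Gs))" if "length xs = k" for xs
    using t that by (intro recf_eval.comp[where ys = "map (\<lambda>G. G xs) Gs"] f)
      (auto simp: list_all2_conv_all_nth)
  then show ?thesis unfolding recursive_def by blast
qed

lemma recursive_comp1:
  assumes "recursive 1 (\<lambda>xs. h (xs ! 0))" "recursive k f"
  shows "recursive k (\<lambda>xs. h (f xs))"
  using recursive_comp[of "[f]" "\<lambda>xs. h (xs ! 0)" k] assms by simp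

lemma recursive_comp2:
  assumes "recursive 2 (\<lambda>xs. h (xs ! 0) (xs ! 1))" "recursive k f" "recursive k g"
  shows "recursive k (\<lambda>xs. h (f xs) (g xs))"
  using recursive_comp[of "[f, g]" "\<lambda>xs. h (xs ! 0) (xs ! 1)" k] assms
  by (auto simp: numeral_2_eq_2)

text \<open>\<open>PrimRec\<close> counts down the head of its argument list, which yields a
  function of arity \<open>Suc k\<close>. Composing it with \<open>c\<close> and the
  \<open>k\<close> projections puts the count in front of the parameters.\<close>

lemma recursive_rec_nat:
  assumes "recursive k b" "recursive (Suc (Suc k)) s" "recursive k c"
  shows "recursive k (\<lambda>xs. rec_nat (b xs) (\<lambda>m r. s (m # r # xs)) (c xs))"
proof -
  obtain b' s' where
    b': "\<And>xs. length xs = k \<Longrightarrow> recf_eval b' xs (b xs)" and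
    s': "\<And>xs. length xs = Suc (Suc k) \<Longrightarrow> recf_eval s' xs (s xs)"
    using assms by (auto simp: recursive_def)
  have rec: "recf_eval (PrimRec b' s') (n # xs) (rec_nat (b xs) (\<lambda>m r. s (m # r # xs)) n)"
    if "length xs = k" for n xs
    using that by (induction n) (auto intro: recf_eval.prec_0 b' intro!: recf_eval.prec_Suc s')
  define F where "F xs = rec_nat (b (tl xs)) (\<lambda>m r. s (m # r # tl xs)) (hd xs)" for xs
  have "recf_eval (PrimRec b' s') xs (F xs)" if "length xs = Suc k" for xs
    using rec[of "tl xs" "hd xs"] that by (cases xs) (auto simp: F_def)
  then have "recursive (Suc k) F"
    unfolding recursive_def by blast
  then have "recursive k (\<lambda>xs. F (map (\<lambda>G. G xs) (c # map (\<lambda>i xs. xs ! i) [0..<k])))"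
    using assms(3) by (intro recursive_comp) (auto intro: recursive_nth)
  then show ?thesis
    by (rule recursive_cong) (auto simp: F_def comp_def map_nth)
qed

section \<open>Arithmetic and the pairing function\<close>

lemma recursive_Suc: "recursive k f \<Longrightarrow> recursive k (\<lambda>xs. Suc (f xs))"
proof (rule recursive_comp1[where h = Suc])
  show "recursive 1 (\<lambda>xs. Suc (xs ! 0))"
    unfolding recursive_def using recf_eval.succ
    by (metis One_nat_def length_0_conv length_Suc_conv nth_Cons_0)
qed

lemma recursive_const: "recursive k (\<lambda>_. c)"
proof (induction c)
  case 0
  then show ?case unfolding recursive_def using recf_eval.zero by blast
qed (rule recursive_Suc)

lemma recursive_add:
  "recursive k f \<Longrightarrow> recursive k g \<Longrightarrow> recursive k (\<lambda>xs. f xs + g xs)"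
proof (rule recursive_comp2[where h = "(+)"])
  have "recursive 2 (\<lambda>xs. rec_nat (xs ! 1) (\<lambda>m r. Suc ((m # r # xs) ! 1)) (xs ! 0))"
    by (intro recursive_rec_nat recursive_Suc recursive_nth) auto
  moreover have "rec_nat b (\<lambda>m r. Suc ((m # r # xs) ! 1)) a = a + b" for a b and xs :: "nat list"
    by (induction a) auto
  ultimately show "recursive 2 (\<lambda>xs. xs ! 0 + xs ! 1)"
    by simp
qed

lemma recursive_pred: "recursive k f \<Longrightarrow> recursive k (\<lambda>xs. f xs - 1)"
proof -
  assume "recursive k f"
  then have "recursive k (\<lambda>xs. rec_nat 0 (\<lambda>m r. (m # r # xs) ! 0) (f xs))"
    by (intro recursive_rec_nat recursive_const recursive_nth) auto
  moreover have "rec_nat 0 (\<lambda>m r. (m # r # xs) ! 0) a = a - 1" for a and xs :: "nat list"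
    by (cases a) auto
  ultimately show ?thesis
    by simp
qed

lemma recursive_diff:
  "recursive k f \<Longrightarrow> recursive k g \<Longrightarrow> recursive k (\<lambda>xs. f xs - g xs)"
proof (rule recursive_comp2[where h = "(-)"])
  have "recursive 2 (\<lambda>xs. rec_nat (xs ! 0) (\<lambda>m r. (m # r # xs) ! 1 - 1) (xs ! 1))"
    by (intro recursive_rec_nat recursive_pred recursive_nth) auto
  moreover have "rec_nat b (\<lambda>m r. (m # r # xs) ! 1 - 1) a = b - a" for a b and xs :: "nat list"
    by (induction a) auto
  ultimately show "recursive 2 (\<lambda>xs. xs ! 0 - xs ! 1)"
    by simp
qed

lemma recursive_if_0:
  assumes "recursive k c" "recursive k f" "recursive k g"
  shows "recursive k (\<lambda>xs. if c xs = 0 then f xs else g xs)"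
proof -
  \<comment> \<open>Entry 4 of \<open>m # r # xs\<close> is the third argument: zero rounds leave
    the second argument, and any positive number of rounds overwrites it with the third.\<close>
  have "recursive 3 (\<lambda>xs. rec_nat (xs ! 1) (\<lambda>m r. (m # r # xs) ! 4) (xs ! 0))"
    by (intro recursive_rec_nat recursive_nth) auto
  then have "recursive k (\<lambda>xs. rec_nat (f xs) (\<lambda>m r. g xs) (c xs))"
    using recursive_comp[of "[c, f, g]" "\<lambda>xs. rec_nat (xs ! 1) (\<lambda>m r. (m # r # xs) ! 4) (xs ! 0)" k]
      assms by (auto simp: eval_nat_numeral)
  moreover have "rec_nat a (\<lambda>m r. b) n = (if n = 0 then a else b)" for a b n :: nat
    by (cases n) auto
  ultimately show ?thesis
    by simp
qed

lemma recursive_triangle: "recursive k f \<Longrightarrow> recursive k (\<lambda>xs. triangle (f xs))"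
proof -
  assume "recursive k f"
  then have "recursive k (\<lambda>xs. rec_nat 0 (\<lambda>m r. (m # r # xs) ! 1 + Suc ((m # r # xs) ! 0)) (f xs))"
    by (intro recursive_rec_nat recursive_const recursive_nth recursive_add recursive_Suc) auto
  moreover have "rec_nat 0 (\<lambda>m r. (m # r # xs) ! 1 + Suc ((m # r # xs) ! 0)) a = triangle a"
    for a and xs :: "nat list"
    by (induction a) auto
  ultimately show ?thesis
    by simp
qed

lemma recursive_prod_encode:
  "recursive k f \<Longrightarrow> recursive k g \<Longrightarrow> recursive k (\<lambda>xs. prod_encode (f xs, g xs))"
  unfolding prod_encode_def by (simp add: recursive_add recursive_triangle)

text \<open>The index \<open>m + n\<close> of the diagonal that contains the pair \<open>(m, n)\<close> with the given code.\<close>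

definition diagonal :: "nat \<Rightarrow> nat"
  where "diagonal = rec_nat 0 (\<lambda>m r. if triangle (Suc r) - Suc m = 0 then Suc r else r)"

text \<open>From \<open>n\<close> to \<open>Suc n\<close> the diagonal rises by at most one, and it
  does so exactly when \<open>Suc n\<close> reaches the next triangular number. The truncated
  difference in \<open>diagonal\<close> tests this.\<close>

lemma diagonal_bounds: "triangle (diagonal n) \<le> n \<and> n < triangle (Suc (diagonal n))"
  by (induction n) (auto simp: diagonal_def)

text \<open>The code of \<open>(m, n)\<close> is \<open>triangle (m + n) + m\<close>, so the offset
  on the diagonal is the first component. The upper bound on the offset keeps the second subtraction
  from being truncated.\<close>

lemma prod_decode_diagonal:
  "prod_decode n = (n - triangle (diagonal n), diagonal n - (n - triangle (diagonal n)))"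
proof -
  have "prod_encode (n - triangle (diagonal n), diagonal n - (n - triangle (diagonal n))) = n"
    using diagonal_bounds[of n] by (simp add: prod_encode_def)
  then show ?thesis
    by (metis prod_encode_inverse)
qed

lemma recursive_diagonal: "recursive k f \<Longrightarrow> recursive k (\<lambda>xs. diagonal (f xs))"
proof -
  assume "recursive k f"
  then have "recursive k (\<lambda>xs. rec_nat 0 (\<lambda>m r.
     if triangle (Suc ((m # r # xs) ! 1)) - Suc ((m # r # xs) ! 0) = 0
     then Suc ((m # r # xs) ! 1) else (m # r # xs) ! 1) (f xs))"
    by (intro recursive_rec_nat recursive_const recursive_nth recursive_Suc recursive_if_0
        recursive_diff recursive_triangle) auto
  then show ?thesis
    by (simp add: diagonal_def cong: if_cong)
qed

section \<open>Computable functions and predicates of one argument\<close>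

text \<open>Several variables are packed into one argument with \<open>prod_encode\<close>. Hence the body of a
  recursion or quantifier, which sees further variables, is a function of a nested pair.\<close>

abbreviation "pfst n \<equiv> fst (prod_decode n)"
abbreviation "psnd n \<equiv> snd (prod_decode n)"

definition computable :: "(nat \<Rightarrow> nat) \<Rightarrow> bool"
  where "computable f \<longleftrightarrow> recursive 1 (\<lambda>xs. f (xs ! 0))"

definition decidable_pred :: "(nat \<Rightarrow> bool) \<Rightarrow> bool"
  where "decidable_pred P \<longleftrightarrow> computable (\<lambda>e. if P e then 1 else 0)"

lemma decidable_iff_decidable_pred: "decidable L \<longleftrightarrow> decidable_pred (\<lambda>n. n \<in> L)"
proof -
  have "(\<forall>xs. length xs = 1 \<longrightarrow> Q xs (xs ! 0)) \<longleftrightarrow> (\<forall>n. Q [n] n)"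
    for Q :: "nat list \<Rightarrow> nat \<Rightarrow> bool"
    by (auto simp: length_Suc_conv)
  \<comment> \<open>The placeholder stands for the term \<open>f\<close>, so the equivalence applies
    below the quantifier over terms.\<close>
  from this[of "\<lambda>xs n. recf_eval _ xs (if n \<in> L then 1 else 0)"] show ?thesis
    by (simp add: decidable_def decidable_pred_def computable_def recursive_def)
qed

lemma computable_comp: "computable h \<Longrightarrow> computable f \<Longrightarrow> computable (\<lambda>e. h (f e))"
  unfolding computable_def by (rule recursive_comp1)

lemma computable_id: "computable (\<lambda>e. e)"
  unfolding computable_def by (rule recursive_nth) simp

lemma computable_const: "computable (\<lambda>e. c)"
  unfolding computable_def by (rule recursive_const)

lemma computable_Suc: "computable f \<Longrightarrow> computable (\<lambda>e. Suc (f e))"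
  unfolding computable_def by (rule recursive_Suc)

lemma computable_diff: "computable f \<Longrightarrow> computable g \<Longrightarrow> computable (\<lambda>e. f e - g e)"
  unfolding computable_def by (rule recursive_diff)

lemma computable_prod_encode:
  "computable f \<Longrightarrow> computable g \<Longrightarrow> computable (\<lambda>e. prod_encode (f e, g e))"
  unfolding computable_def by (rule recursive_prod_encode)

lemma computable_pfst: "computable f \<Longrightarrow> computable (\<lambda>e. pfst (f e))"
  unfolding computable_def prod_decode_diagonal fst_conv
  by (intro recursive_diff recursive_triangle recursive_diagonal)

lemma computable_psnd: "computable f \<Longrightarrow> computable (\<lambda>e. psnd (f e))"
  unfolding computable_def prod_decode_diagonal snd_conv
  by (intro recursive_diff recursive_triangle recursive_diagonal)

lemma computable_if:
  assumes "decidable_pred P" "computable f" "computable g"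
  shows "computable (\<lambda>e. if P e then f e else g e)"
proof -
  have "recursive 1 (\<lambda>xs. if (if P (xs ! 0) then 1 else 0 :: nat) = 0 then g (xs ! 0) else f (xs ! 0))"
    using assms unfolding decidable_pred_def computable_def by (intro recursive_if_0)
  moreover have "(if (if b then 1 else 0 :: nat) = 0 then y else x) = (if b then x else y)"
    for b and x y :: nat
    by simp
  ultimately show ?thesis
    unfolding computable_def by simp
qed

lemma computable_rec_nat:
  assumes "computable b"
    and s: "computable (\<lambda>z. s (pfst z) (pfst (psnd z)) (psnd (psnd z)))"
    and "computable c"
  shows "computable (\<lambda>e. rec_nat (b e) (\<lambda>m r. s m r e) (c e))"
proof -
  \<comment> \<open>Packing counter, previous value and parameter into a nested pair turns the unary
    body into a ternary one.\<close>
  have "recursive 3 (\<lambda>zs. prod_encode (zs ! 0, prod_encode (zs ! 1, zs ! 2)))"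
    by (intro recursive_prod_encode recursive_nth) auto
  from recursive_comp1[OF s[unfolded computable_def] this]
  have "recursive 3 (\<lambda>zs. s (zs ! 0) (zs ! 1) (zs ! 2))"
    by simp
  then have "recursive 1 (\<lambda>xs. rec_nat (b (xs ! 0))
      (\<lambda>m r. (\<lambda>zs. s (zs ! 0) (zs ! 1) (zs ! 2)) (m # r # xs)) (c (xs ! 0)))"
    using assms(1,3) unfolding computable_def
    by (intro recursive_rec_nat) (simp_all add: eval_nat_numeral)
  then show ?thesis
    by (simp add: computable_def)
qed

lemma decidable_pred_not:
  assumes "decidable_pred P"
  shows "decidable_pred (\<lambda>e. \<not> P e)"
proof -
  have "computable (\<lambda>e. if P e then 0 else 1)"
    by (intro computable_if computable_const assms)
  then show ?thesis
    unfolding decidable_pred_def by (rule back_subst[of computable]) auto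
qed

lemma decidable_pred_conj:
  assumes "decidable_pred P" "decidable_pred Q"
  shows "decidable_pred (\<lambda>e. P e \<and> Q e)"
proof -
  have "computable (\<lambda>e. if P e then (if Q e then 1 else 0) else 0)"
    by (intro computable_if computable_const assms)
  then show ?thesis
    unfolding decidable_pred_def by (rule back_subst[of computable]) auto
qed

lemma decidable_pred_eq:
  assumes "computable f" "computable g"
  shows "decidable_pred (\<lambda>e. f e = g e)"
proof -
  have le: "decidable_pred (\<lambda>e. f e \<le> g e)" if "computable f" "computable g" for f g
  proof -
    \<comment> \<open>With truncated subtraction this is 1 if \<open>f e \<le> g e\<close> and 0
      otherwise.\<close>
    have "computable (\<lambda>e. 1 - (f e - g e))"
      using that by (intro computable_diff computable_const)
    then show ?thesis
      unfolding decidable_pred_def by (rule back_subst[of computable]) auto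
  qed
  have "decidable_pred (\<lambda>e. f e \<le> g e \<and> g e \<le> f e)"
    using assms by (intro decidable_pred_conj le)
  then show ?thesis
    by (rule back_subst[of decidable_pred]) auto
qed

section \<open>Recursion and quantification over coded lists\<close>

lemma length_le_list_encode: "length xs \<le> list_encode xs"
  by (induction xs) (auto intro: order_trans[OF _ le_prod_encode_2])

text \<open>The state of the recursion pairs the code of the remaining list with the accumulator. A
  list is no longer than its code, so \<open>l e\<close> rounds exhaust it, and surplus rounds leave
  the state unchanged.\<close>

lemma computable_fold:
  assumes F: "computable (\<lambda>z. F (pfst z) (pfst (psnd z)) (psnd (psnd z)))"
    and l: "computable l" and b: "computable b"
  shows "computable (\<lambda>e. fold (\<lambda>x acc. F x acc e) (list_decode (l e)) (b e))"
proof -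
  \<comment> \<open>The empty list has code 0 and \<open>x # xs\<close> has code
    \<open>Suc (prod_encode (x, list_encode xs))\<close>, so subtracting 1 exposes head and
    tail.\<close>
  define step where "step r e = (if pfst r = 0 then r
    else prod_encode (psnd (pfst r - 1), F (pfst (pfst r - 1)) (psnd r) e))" for r e
  have step: "rec_nat (prod_encode (list_encode xs, a)) (\<lambda>m r. step r e) n
      = prod_encode (list_encode (drop n xs), fold (\<lambda>x acc. F x acc e) (take n xs) a)" for xs a e n
  proof (induction n)
    case (Suc n)
    show ?case
    proof (cases "n < length xs")
      case True
      then show ?thesis
        using Suc by (simp add: step_def Cons_nth_drop_Suc[symmetric] take_Suc_conv_app_nth)
    qed (use Suc in \<open>simp add: step_def\<close>)
  qed simp
  have "computable (\<lambda>z. F (pfst (pfst (pfst (psnd z)) - 1)) (psnd (pfst (psnd z))) (psnd (psnd z)))"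
    using computable_comp[OF F, of "\<lambda>z. prod_encode (pfst (pfst (pfst (psnd z)) - 1),
        prod_encode (psnd (pfst (psnd z)), psnd (psnd z)))"]
    by (simp add: computable_prod_encode computable_pfst computable_psnd computable_id
        computable_diff computable_const del: One_nat_def)
  then have "computable (\<lambda>e. psnd (rec_nat (prod_encode (l e, b e)) (\<lambda>m r. step r e) (l e)))"
    unfolding step_def
    by (intro computable_psnd computable_rec_nat computable_prod_encode l b computable_if
        decidable_pred_eq computable_pfst computable_diff computable_const computable_id)
  moreover have "psnd (rec_nat (prod_encode (l e, b e)) (\<lambda>m r. step r e) (l e))
      = fold (\<lambda>x acc. F x acc e) (list_decode (l e)) (b e)" for e
    using step[of "list_decode (l e)" "b e" e "l e"] length_le_list_encode[of "list_decode (l e)"]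
    by simp
  ultimately show ?thesis
    by simp
qed

lemma decidable_pred_list_ex:
  assumes P: "decidable_pred (\<lambda>z. P (pfst z) (psnd z))" and l: "computable l"
  shows "decidable_pred (\<lambda>e. \<exists>x\<in>set (list_decode (l e)). P x e)"
proof -
  have "computable (\<lambda>z. if P (pfst z) (psnd (psnd z)) then 1 else 0)"
    using computable_comp[OF P[unfolded decidable_pred_def],
      of "\<lambda>z. prod_encode (pfst z, psnd (psnd z))"]
    by (simp add: computable_prod_encode computable_pfst computable_psnd computable_id)
  then have "computable (\<lambda>e. fold (\<lambda>x acc. if P x e then 1 else acc) (list_decode (l e)) 0)"
    by (intro computable_fold l computable_const computable_if computable_pfst computable_psnd
      computable_id) (simp add: decidable_pred_def)
  moreover have "fold (\<lambda>x acc. if P x e then 1 else acc) xs a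
      = (if \<exists>x\<in>set xs. P x e then 1 else a)" for e xs and a :: nat
    by (induction xs arbitrary: a) auto
  ultimately show ?thesis
    by (simp add: decidable_pred_def)
qed

lemma decidable_pred_list_all:
  assumes P: "decidable_pred (\<lambda>z. P (pfst z) (psnd z))" and l: "computable l"
  shows "decidable_pred (\<lambda>e. \<forall>x\<in>set (list_decode (l e)). P x e)"
  using decidable_pred_not[OF decidable_pred_list_ex[OF decidable_pred_not[OF P] l]] by simp

text \<open>Takes \<open>i\<close> tails and then a head; each subtraction of 1 removes the
  successor in the code of a nonempty list.\<close>

definition code_nth :: "nat \<Rightarrow> nat \<Rightarrow> nat"
  where "code_nth c i = pfst (rec_nat c (\<lambda>_ c. psnd (c - 1)) i - 1)"

lemma code_nth_list_encode:
  assumes "i < length xs"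
  shows "code_nth (list_encode xs) i = xs ! i"
proof -
  have "rec_nat (list_encode xs) (\<lambda>_ c. psnd (c - 1)) i = list_encode (drop i xs)"
    using assms by (induction i) (auto simp: Cons_nth_drop_Suc[symmetric])
  then show ?thesis
    using assms by (simp add: code_nth_def Cons_nth_drop_Suc[symmetric])
qed

lemma computable_code_nth:
  "computable c \<Longrightarrow> computable i \<Longrightarrow> computable (\<lambda>e. code_nth (c e) (i e))"
  unfolding code_nth_def
  by (intro computable_pfst computable_diff computable_const computable_rec_nat
      computable_psnd computable_id)

text \<open>A counter that returns to 0 on reaching \<open>M\<close>. For \<open>M = 0\<close> it
  never returns, in accordance with \<open>e mod 0 = e\<close>.\<close>

lemma computable_mod: "computable (\<lambda>e. e mod M)"
proof -
  have "computable (\<lambda>e. rec_nat 0 (\<lambda>m r. if Suc r = M then 0 else Suc r) e)"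
    by (intro computable_rec_nat computable_if decidable_pred_eq computable_const computable_Suc
        computable_pfst computable_psnd computable_id)
  moreover have "rec_nat 0 (\<lambda>m r. if Suc r = M then 0 else Suc r) e = e mod M" for e
    by (induction e) (auto simp: mod_Suc)
  ultimately show ?thesis
    by simp
qed

text \<open>Finitely many case distinctions suffice, however the values were obtained. This makes a
  table computable even if its entries come from a nonconstructive choice.\<close>

lemma computable_finite_support:
  assumes "finite D" and "\<And>z. z \<notin> D \<Longrightarrow> h z = 0"
  shows "computable h"
  using assms
proof (induction D arbitrary: h)
  case empty
  then have "h = (\<lambda>_. 0)" by auto
  then show ?case using computable_const by simp
next
  case (insert d D)
  have "computable (h(d := 0))"
    by (rule insert.IH) (use insert.prems in auto)
  then have "computable (\<lambda>z. if z = d then h d else (h(d := 0)) z)"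
    by (intro computable_if decidable_pred_eq computable_id computable_const)
  then show ?case
    by (rule back_subst[of computable]) auto
qed

text \<open>The fold puts each new value in front of the earlier ones, hence the reversal. It does
  no harm where only equality of the results matters.\<close>

lemma computable_list_map_rev:
  assumes "computable f" "computable l"
  shows "computable (\<lambda>e. list_encode (rev (map f (list_decode (l e)))))"
proof -
  have "fold (\<lambda>x acc. Suc (prod_encode (f x, acc))) xs (list_encode ys)
      = list_encode (rev (map f xs) @ ys)" for xs ys
  proof (induction xs arbitrary: ys)
    case (Cons x xs)
    show ?case using Cons[of "f x # ys"] by simp
  qed simp
  from this[of _ "[]"] have "fold (\<lambda>x acc. Suc (prod_encode (f x, acc))) xs 0
      = list_encode (rev (map f xs))" for xs
    by simp
  moreover have "computable (\<lambda>e. fold (\<lambda>x acc. Suc (prod_encode (f x, acc))) (list_decode (l e)) 0)"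
    by (intro computable_fold computable_Suc computable_prod_encode computable_const
        computable_comp[OF assms(1)] assms(2) computable_pfst computable_psnd computable_id)
  ultimately show ?thesis
    by simp
qed

lemma decidable_pred_length:
  assumes "computable l"
  shows "decidable_pred (\<lambda>e. length (list_decode (l e)) = d)"
proof -
  have "fold (\<lambda>x. Suc) xs a = length xs + a" for a and xs :: "nat list"
    by (induction xs arbitrary: a) auto
  moreover have "decidable_pred (\<lambda>e. fold (\<lambda>x acc. Suc acc) (list_decode (l e)) 0 = d)"
    using assms by (intro decidable_pred_eq computable_fold computable_Suc computable_const
        computable_pfst computable_psnd computable_id)
  ultimately show ?thesis
    by simp
qed

text \<open>The accumulator pairs a flag, which is 1 until a value repeats, with the list of values
  seen so far; the induction generalises over both.\<close>

lemma decidable_pred_distinct: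
  assumes "computable f" "computable l"
  shows "decidable_pred (\<lambda>e. distinct (map f (list_decode (l e))))"
proof -
  define step where "step x acc =
    prod_encode (if pfst acc = 1 \<and> \<not> (\<exists>y\<in>set (list_decode (psnd acc)). y = f x) then 1 else 0,
      Suc (prod_encode (f x, psnd acc)))" for x acc
  have step: "pfst (fold step xs (prod_encode (if b then 1 else 0, list_encode ys))) =
      (if b \<and> distinct (map f xs) \<and> f ` set xs \<inter> set ys = {} then 1 else 0)" for b xs ys
  proof (induction xs arbitrary: b ys)
    case (Cons x xs)
    have "step x (prod_encode (if b then 1 else 0, list_encode ys))
        = prod_encode (if b \<and> f x \<notin> set ys then 1 else 0, list_encode (f x # ys))"
      by (auto simp: step_def)
    then show ?case
      by (simp only: fold_Cons comp_def Cons.IH) auto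
  qed simp
  have "decidable_pred (\<lambda>e. pfst (fold (\<lambda>x acc. step x acc) (list_decode (l e)) (prod_encode (1, 0))) = 1)"
    unfolding step_def
    by (intro decidable_pred_eq computable_fold computable_Suc computable_const assms(2)
        computable_pfst computable_psnd computable_id computable_prod_encode computable_if
        decidable_pred_conj decidable_pred_not decidable_pred_list_ex computable_comp[OF assms(1)])
  then show ?thesis
    using step[of _ True "[]"] by (simp split: if_splits)
qed

text \<open>The search over lists of length \<open>k\<close> is a nest of \<open>k\<close> bounded
  quantifiers. \<open>pfst z\<close> codes the suffix chosen so far, which grows at the front;
  \<open>psnd z\<close> carries the parameters.\<close>

lemma decidable_pred_ex_list:
  assumes P: "decidable_pred (\<lambda>z. P (pfst z) (psnd z))" and l: "computable l"
  shows "decidable_pred (\<lambda>z. \<exists>g. length g = k \<and> set g \<subseteq> set (list_decode (l (psnd z)))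
    \<and> P (list_encode (g @ list_decode (pfst z))) (psnd z))"
proof (induction k)
  case 0
  then show ?case using P by simp
next
  case (Suc k)
  define Q where "Q w e \<longleftrightarrow> (\<exists>g. length g = k \<and> set g \<subseteq> set (list_decode (l e))
    \<and> P (list_encode (g @ list_decode w)) e)" for w e
  have Q: "decidable_pred (\<lambda>z. Q (pfst z) (psnd z))"
    using Suc by (simp add: Q_def)
  have "decidable_pred (\<lambda>z. Q (Suc (prod_encode (pfst z, pfst (psnd z)))) (psnd (psnd z)))"
    using computable_comp[OF Q[unfolded decidable_pred_def],
        of "\<lambda>z. prod_encode (Suc (prod_encode (pfst z, pfst (psnd z))), psnd (psnd z))"]
    by (simp add: decidable_pred_def computable_prod_encode computable_pfst computable_psnd
        computable_id computable_Suc)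
  then have "decidable_pred (\<lambda>z. \<exists>x\<in>set (list_decode (l (psnd z))).
      Q (Suc (prod_encode (x, pfst z))) (psnd z))"
    by (intro decidable_pred_list_ex computable_comp[OF l] computable_psnd computable_id)
  moreover have "(\<exists>x\<in>set (list_decode (l e)). Q (Suc (prod_encode (x, w))) e) \<longleftrightarrow>
     (\<exists>g. length g = Suc k \<and> set g \<subseteq> set (list_decode (l e))
      \<and> P (list_encode (g @ list_decode w)) e)" (is "?L \<longleftrightarrow> ?R") for w e
  proof
    assume ?L
    then obtain x g where "x \<in> set (list_decode (l e))" "length g = k" "set g \<subseteq> set (list_decode (l e))"
      "P (list_encode ((g @ [x]) @ list_decode w)) e"
      by (auto simp: Q_def)
    then show ?R by (intro exI[of _ "g @ [x]"]) auto
  next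
    assume ?R
    then obtain g where g: "length g = Suc k" "set g \<subseteq> set (list_decode (l e))"
      "P (list_encode (g @ list_decode w)) e"
      by blast
    \<comment> \<open>The outermost quantifier picks the last entry, since later choices are placed
      before it.\<close>
    then obtain g' x where "g = g' @ [x]"
      by (metis length_Suc_conv_rev)
    then show ?L
      using g by (auto simp: Q_def intro!: bexI[of _ x] exI[of _ g'])
  qed
  ultimately show ?case
    by simp
qed

section \<open>Block maps on finite subshifts\<close>

lemma shift_shift: "shift u (shift v x) = shift (u + v) x"
  by (simp add: shift_def fun_eq_iff add.assoc)

lemma shift_0: "shift 0 x = x"
  by (simp add: shift_def)

lemma shift_eq_iff: "shift u x = shift u y \<longleftrightarrow> x = y"
  by (metis add.left_inverse shift_0 shift_shift)

text \<open>A product of discrete spaces is Hausdorff, and a finite Hausdorff space is discrete.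
  Hence continuity imposes nothing on maps from \<open>Y\<close>.\<close>

lemma subshift_finite_discrete:
  fixes Y :: "('d::finite, 'a) config set"
  assumes "subshift A Y" "finite Y"
  shows "subtopology (full_shift A) Y = discrete_topology Y"
proof -
  have "Y \<subseteq> topspace (full_shift A)"
    using assms(1) by (simp add: subshift_def closedin_subset)
  moreover have "Hausdorff_space (full_shift A :: ('d, 'a) config topology)"
    by (simp add: full_shift_def Hausdorff_space_product_topology)
  ultimately show ?thesis
    using assms(2) by (intro finite_topspace_imp_discrete_topology Hausdorff_space_subtopology)
      (auto simp: topspace_subtopology)
qed

text \<open>The correspondence is \<open>\<phi> y v = g (shift v y)\<close>. An occurrence of a
  pattern elsewhere in \<open>\<phi> y\<close> is an occurrence at the origin of the image of
  another element of \<open>Y\<close>, so testing the origin is enough.\<close>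

lemma embeds_SFT_iff_block_map:
  fixes Y :: "('d::finite, 'a) config set"
  assumes Y: "subshift A Y" "finite Y"
  shows "embeds A Y B (SFT B F) \<longleftrightarrow>
    (\<exists>g. (\<forall>y\<in>Y. g y \<in> B)
       \<and> (\<forall>y\<in>Y. \<forall>z\<in>Y. y \<noteq> z \<longrightarrow> (\<exists>v. g (shift v y) \<noteq> g (shift v z)))
       \<and> (\<forall>p\<in>F. \<forall>y\<in>Y. \<exists>v\<in>dom p. p v \<noteq> Some (g (shift v y))))"
    (is "_ \<longleftrightarrow> (\<exists>g. ?B g \<and> ?I g \<and> ?F g)")
proof -
  have closed: "shift u y \<in> Y" if "y \<in> Y" for u y
    using Y(1) that by (simp add: subshift_def)
  have cont: "continuous_map (subtopology (full_shift A) Y) (subtopology (full_shift B) (SFT B F)) \<phi>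
      \<longleftrightarrow> \<phi> ` Y \<subseteq> SFT B F" for \<phi>
    unfolding subshift_finite_discrete[OF Y] by (auto simp: SFT_def)
  show ?thesis
  proof
    assume "embeds A Y B (SFT B F)"
    then obtain \<phi> where sft: "\<phi> ` Y \<subseteq> SFT B F" and inj: "inj_on \<phi> Y"
      and comm: "\<And>u y. y \<in> Y \<Longrightarrow> \<phi> (shift u y) = shift u (\<phi> y)"
      unfolding embeds_def cont by blast
    define g where "g y = \<phi> y 0" for y
    have g: "g (shift v y) = \<phi> y v" if "y \<in> Y" for v y
      using comm[OF that] by (simp add: g_def shift_def)
    have "?B g"
      using sft by (auto simp: g_def SFT_def topspace_full_shift)
    moreover have "?I g"
    proof (intro ballI impI)
      fix y z assume "y \<in> Y" "z \<in> Y" "y \<noteq> z"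
      then have "\<phi> y \<noteq> \<phi> z" using inj by (auto dest: inj_onD)
      then show "\<exists>v. g (shift v y) \<noteq> g (shift v z)"
        using \<open>y \<in> Y\<close> \<open>z \<in> Y\<close> by (auto simp: g)
    qed
    moreover have "?F g"
    proof (intro ballI)
      fix p y assume "p \<in> F" "y \<in> Y"
      then have "\<not> appears p (\<phi> y)"
        using sft by (auto simp: SFT_def)
      then have "\<exists>v\<in>dom p. p v \<noteq> Some (shift 0 (\<phi> y) v)"
        unfolding appears_def by blast
      then show "\<exists>v\<in>dom p. p v \<noteq> Some (g (shift v y))"
        using \<open>y \<in> Y\<close> by (simp add: g shift_0)
    qed
    ultimately show "\<exists>g. ?B g \<and> ?I g \<and> ?F g" by blast
  next
    assume "\<exists>g. ?B g \<and> ?I g \<and> ?F g"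
    then obtain g where g: "?B g" "?I g" "?F g" by blast
    define \<phi> where "\<phi> y = (\<lambda>v. g (shift v y))" for y
    have comm: "\<phi> (shift u y) = shift u (\<phi> y)" for u y
      by (simp add: \<phi>_def shift_shift) (simp add: shift_def)
    have "\<not> appears p (\<phi> y)" if p: "p \<in> F" and y: "y \<in> Y" for p y
    proof
      assume "appears p (\<phi> y)"
      then obtain u where "\<forall>v\<in>dom p. p v = Some (\<phi> (shift u y) v)"
        by (auto simp: appears_def comm)
      with g(3) p closed[OF y] show False
        unfolding \<phi>_def by blast
    qed
    then have "\<phi> ` Y \<subseteq> SFT B F"
      using g(1) closed by (auto simp: SFT_def topspace_full_shift \<phi>_def)
    moreover have "inj_on \<phi> Y"
      using g(2) by (auto simp: inj_on_def \<phi>_def fun_eq_iff)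
    ultimately show "embeds A Y B (SFT B F)"
      unfolding embeds_def cont using comm by blast
  qed
qed

section \<open>A common period and positions modulo it\<close>

lemma shift_multiple:
  assumes "shift (int m *s v) y = y"
  shows "shift (int (m * n) *s v) y = y"
proof (induction n)
  case (Suc n)
  have "int (m * Suc n) *s v = int m *s v + int (m * n) *s v"
    by (simp add: vec_eq_iff algebra_simps)
  then show ?case
    using Suc assms by (metis shift_shift)
qed (simp add: shift_0)

text \<open>Among \<open>card Y + 1\<close> multiples of \<open>v\<close> two shift \<open>y\<close>
  alike, so some positive period along \<open>v\<close> is at most \<open>card Y\<close>. It divides
  \<open>fact (card Y)\<close>, which therefore serves all \<open>v\<close> and
  \<open>y\<close>.\<close>

lemma finite_subshift_periodic:
  fixes Y :: "('d::finite, 'a) config set"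
  assumes "subshift A Y" "finite Y"
  obtains N :: nat where "N > 0" "\<And>v y. y \<in> Y \<Longrightarrow> shift (int N *s v) y = y"
proof
  show "fact (card Y) > (0::nat)" by simp
next
  fix v :: "int ^ 'd" and y assume y: "y \<in> Y"
  let ?f = "\<lambda>m::nat. shift (int m *s v) y"
  have "?f ` {..card Y} \<subseteq> Y"
    using assms(1) y by (auto simp: subshift_def)
  then have "\<not> inj_on ?f {..card Y}"
    using card_inj_on_le[of ?f "{..card Y}" Y] assms(2) by auto
  then obtain a b where ab: "a < b" "b \<le> card Y" "?f a = ?f b"
    by (auto simp: inj_on_def) (metis linorder_neqE_nat)
  have "int b *s v = int a *s v + int (b - a) *s v"
    using ab(1) by (simp add: vec_eq_iff of_nat_diff algebra_simps)
  then have "shift (int a *s v) (shift (int (b - a) *s v) y) = shift (int a *s v) y"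
    using ab(3) by (simp add: shift_shift)
  then have "shift (int (b - a) *s v) y = y"
    by (simp add: shift_eq_iff)
  moreover have "b - a dvd fact (card Y)"
    using ab by (intro dvd_fact) auto
  ultimately show "shift (int (fact (card Y)) *s v) y = y"
    by (metis dvdE shift_multiple)
qed

text \<open>Even numbers code nonnegative integers and odd numbers negative ones, with the magnitude
  given by the half. Adding \<open>2 * N * q\<close> keeps the parity and moves the integer by
  \<open>N * q\<close> up or down.\<close>

lemma int_decode_mod_double:
  assumes "a mod (2 * N) = b mod (2 * N)"
  shows "int_decode a mod int N = int_decode b mod int N"
proof -
  have *: "int_decode (m + 2 * N * q) mod int N = int_decode m mod int N" for m q
  proof -
    have e: "even (m + 2 * N * q) = even m" "(m + 2 * N * q) div 2 = m div 2 + N * q"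
      by (auto simp: mult.assoc)
    have "(- (int (m div 2) + int N * int q) - 1) mod int N = (- int (m div 2) - 1) mod int N"
      by (metis (no_types, opaque_lifting) add_uminus_conv_diff diff_diff_eq add.commute
          minus_add_distrib mod_mult_self2 mult_minus_right)
    then show ?thesis
      by (simp add: int_decode_def sum_decode_def e)
  qed
  have "int_decode c mod int N = int_decode (c mod (2 * N)) mod int N" for c
    using *[of "c mod (2 * N)" "c div (2 * N)"] by simp
  then show ?thesis
    using assms by metis
qed

lemma position_code_mod_cong:
  fixes v w :: "int ^ 'd::finite"
  assumes "map (\<lambda>x. x mod (2 * N)) (list_decode (position_code v))
    = map (\<lambda>x. x mod (2 * N)) (list_decode (position_code w))"
  obtains u where "v = w + int N *s u"
proof -
  have "v $ i mod int N = w $ i mod int N" for i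
  proof -
    have "i \<in> from_nat_into UNIV ` {..<CARD('d)}"
      using bij_betw_from_nat_into_finite[of "UNIV :: 'd set"] by (simp add: bij_betw_def)
    then have "int_encode (v $ i) mod (2 * N) = int_encode (w $ i) mod (2 * N)"
      using assms by (auto simp: position_code_def)
    then show ?thesis
      using int_decode_mod_double by fastforce
  qed
  then have "int N dvd v $ i - w $ i" for i
    by (simp add: mod_eq_dvd_iff)
  then have "v = w + int N *s (\<chi> i. (v $ i - w $ i) div int N)"
    by (simp add: vec_eq_iff)
  then show ?thesis using that by blast
qed

lemma length_position_code:
  "length (list_decode (position_code (v :: int ^ 'd::finite))) = CARD('d)"
  by (simp add: position_code_def)

text \<open>The coding of integers is onto, so the length is the only restriction on a list of
  coordinate codes.\<close>

lemma position_code_surj: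
  assumes "length (list_decode q) = CARD('d::finite)"
  shows "\<exists>v :: int ^ 'd. position_code v = q"
proof
  let ?v = "\<chi> i. int_decode (list_decode q ! to_nat_on (UNIV :: 'd set) i)"
  have "map (\<lambda>j. int_encode (?v $ from_nat_into UNIV j)) [0..<CARD('d)] = list_decode q"
    using assms bij_betw_imp_surj_on[OF to_nat_on_finite[of "UNIV :: 'd set"]]
    by (intro nth_equalityI) auto
  then show "position_code ?v = q"
    by (simp add: position_code_def)
qed

section \<open>The decision procedure\<close>

text \<open>By the common period, \<open>shift v\<close> on \<open>Y\<close> depends only on the
  residues of the coordinate codes. There are finitely many residue lists, so the action on indices
  into \<open>ys\<close> is a finite table.\<close>

lemma shift_table:
  fixes Y :: "('d::finite, 'a) config set"
  assumes Y: "subshift A Y" "finite Y" and ys: "set ys = Y"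
  obtains \<tau> where "computable (\<lambda>z. \<tau> (pfst z) (psnd z))"
    "\<And>v :: int ^ 'd. \<And>i. i < length ys \<Longrightarrow>
      \<tau> (position_code v) i < length ys \<and> ys ! \<tau> (position_code v) i = shift v (ys ! i)"
proof -
  obtain N where N: "N > 0" "\<And>v y. y \<in> Y \<Longrightarrow> shift (int N *s v) y = y"
    using finite_subshift_periodic[OF Y] by blast
  \<comment> \<open>The modulus is \<open>2 * N\<close> because the code of an integer also stores
    its sign in its parity.\<close>
  define R where "R q = list_encode (rev (map (\<lambda>x. x mod (2 * N)) (list_decode q)))" for q
  have shift_eq: "shift v y = shift w y"
    if R: "R (position_code v) = R (position_code w)" and y: "y \<in> Y" for v w :: "int ^ 'd" and y
  proof -
    obtain u where "v = w + int N *s u"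
      by (rule position_code_mod_cong[of N v w]) (use R in \<open>simp add: R_def list_encode_eq\<close>)
    then show ?thesis
      using N(2)[OF y, of u] by (metis shift_shift)
  qed
  have "R (position_code v) \<in> list_encode ` {xs. set xs \<subseteq> {..<2 * N} \<and> length xs = CARD('d)}"
    for v :: "int ^ 'd"
    using N(1) unfolding R_def by (intro imageI) (auto simp: length_position_code)
  then have "range (\<lambda>v :: int ^ 'd. R (position_code v))
      \<subseteq> list_encode ` {xs. set xs \<subseteq> {..<2 * N} \<and> length xs = CARD('d)}"
    by auto
  then have fin: "finite (range (\<lambda>v :: int ^ 'd. R (position_code v)))"
    by (rule finite_subset) (intro finite_imageI finite_lists_length_eq finite_lessThan)
  define Q where "Q r i j \<longleftrightarrow>
    j < length ys \<and> (\<exists>v :: int ^ 'd. R (position_code v) = r \<and> ys ! j = shift v (ys ! i))" for r i j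
  define D where
    "D = prod_encode ` (range (\<lambda>v :: int ^ 'd. R (position_code v)) \<times> {..<length ys})"
  \<comment> \<open>A choice of table entries, with default 0 outside the finite set
    \<open>D\<close> so that \<open>h\<close> has finite support.\<close>
  define h where "h z = (if z \<in> D then SOME j. Q (pfst z) (psnd z) j else 0)" for z
  have comp_h: "computable h"
    by (rule computable_finite_support[of D]) (auto simp: D_def h_def fin)
  have comp_R: "computable R"
    unfolding R_def by (intro computable_list_map_rev computable_mod computable_id)
  have "computable (\<lambda>z. h (prod_encode (R (pfst z), psnd z)))"
    by (intro computable_comp[OF comp_h] computable_prod_encode computable_comp[OF comp_R]
        computable_pfst computable_psnd computable_id)
  moreover have "h (prod_encode (R (position_code v), i)) < length ys
      \<and> ys ! h (prod_encode (R (position_code v), i)) = shift v (ys ! i)"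
    if i: "i < length ys" for v :: "int ^ 'd" and i
  proof -
    have yi: "ys ! i \<in> Y" using i ys by auto
    then have "shift v (ys ! i) \<in> set ys" using Y(1) ys by (simp add: subshift_def)
    then have "\<exists>j. Q (R (position_code v)) i j"
      unfolding Q_def in_set_conv_nth by metis
    then have "Q (R (position_code v)) i (SOME j. Q (R (position_code v)) i j)"
      by (rule someI_ex)
    moreover have "h (prod_encode (R (position_code v), i)) = (SOME j. Q (R (position_code v)) i j)"
      using i by (simp add: h_def D_def)
    \<comment> \<open>\<open>Q\<close> provides some position with the same residues as
      \<open>v\<close>; by \<open>shift_eq\<close> it shifts \<open>ys ! i\<close> just as
      \<open>v\<close> does.\<close>
    ultimately show ?thesis
      unfolding Q_def using shift_eq yi by metis
  qed
  ultimately show ?thesis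
    by (rule that[of "\<lambda>q i. h (prod_encode (R q, i))"])
qed

section \<open>Recognising the codes of valid inputs\<close>

text \<open>Here \<open>d\<close> is the dimension. Membership in the alphabet is written as a
  bounded search to match the closure rules for decidable predicates.\<close>

definition well_formed_code :: "nat \<Rightarrow> nat \<Rightarrow> bool"
  where "well_formed_code d n \<longleftrightarrow> (\<forall>p\<in>set (list_decode (psnd n)).
    distinct (map (\<lambda>x. pfst x) (list_decode p)) \<and>
    (\<forall>x\<in>set (list_decode p). length (list_decode (pfst x)) = d \<and>
      (\<exists>a\<in>set (list_decode (pfst n)). a = psnd x)))"

lemma decidable_pred_well_formed_code: "decidable_pred (\<lambda>e. well_formed_code d e)"
  unfolding well_formed_code_def
  by (intro decidable_pred_list_all decidable_pred_conj decidable_pred_distinct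
      decidable_pred_length decidable_pred_list_ex decidable_pred_eq computable_const
      computable_pfst computable_psnd computable_id)

lemma list_decode_pattern_code:
  "list_decode (pattern_code p) = map (\<lambda>x. prod_encode (position_code (fst x), snd x)) p"
  by (simp add: pattern_code_def case_prod_unfold)

text \<open>Injectivity of \<open>position_code\<close> makes distinct positions the same as
  distinct position codes.\<close>

lemma well_formed_input_code:
  "well_formed_code CARD('d) (input_code (I :: 'd::finite sft_input)) \<longleftrightarrow> valid_input I"
proof -
  have "distinct (map (\<lambda>x. position_code (fst x)) p) \<longleftrightarrow> distinct (map fst p)"
    for p :: "((int ^ 'd) \<times> nat) list"
    using distinct_map[of position_code "map fst p"]
    by (simp add: comp_def inj_on_subset[OF inj_position_code])
  then show ?thesis
    by (auto simp: well_formed_code_def valid_input_def input_alphabet_def input_code_def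
        list_decode_pattern_code comp_def length_position_code)
qed

text \<open>Every number decodes to a list or a pair; only a position code can fail, and the length
  check excludes that.\<close>

lemma ex_input_code:
  assumes "well_formed_code CARD('d::finite) n"
  shows "\<exists>I :: 'd sft_input. input_code I = n"
proof -
  have "\<forall>q. \<exists>v :: int ^ 'd. length (list_decode q) = CARD('d) \<longrightarrow> position_code v = q"
    using position_code_surj by blast
  then obtain dec :: "nat \<Rightarrow> int ^ 'd"
    where dec: "\<And>q. length (list_decode q) = CARD('d) \<Longrightarrow> position_code (dec q) = q"
    by metis
  let ?pat = "\<lambda>p. map (\<lambda>x. (dec (pfst x), psnd x)) (list_decode p)"
  have pat: "pattern_code (?pat p) = p" if "p \<in> set (list_decode (psnd n))" for p
  proof -
    have "map ((\<lambda>(v, a). prod_encode (position_code v, a)) \<circ> (\<lambda>x. (dec (pfst x), psnd x))) (list_decode p)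
        = list_decode p"
      using assms that by (intro map_idI) (auto simp: dec well_formed_code_def)
    then show ?thesis
      by (simp add: pattern_code_def)
  qed
  have "map (pattern_code \<circ> ?pat) (list_decode (psnd n)) = list_decode (psnd n)"
    using pat by (intro map_idI) auto
  then have "input_code (list_decode (pfst n), map ?pat (list_decode (psnd n))) = n"
    by (simp add: input_code_def)
  then show ?thesis by blast
qed

section \<open>Embeddings as lists of symbols\<close>

text \<open>A block map is the list \<open>G\<close> of its values along \<open>ys\<close>, and
  shifting becomes the action of \<open>\<tau>\<close> on indices. Since \<open>ys\<close> is
  distinct, \<open>G\<close> may be arbitrary, and different indices mean different
  configurations.\<close>

lemma embeds_SFT_iff_list:
  fixes Y :: "('d::finite, 'a) config set" and \<tau> :: "int ^ 'd \<Rightarrow> nat \<Rightarrow> nat"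
  assumes Y: "subshift A Y" "finite Y" and ys: "set ys = Y" "distinct ys"
    and \<tau>: "\<And>v i. i < length ys \<Longrightarrow> \<tau> v i < length ys \<and> ys ! \<tau> v i = shift v (ys ! i)"
  shows "embeds A Y B (SFT B F) \<longleftrightarrow>
    (\<exists>G. length G = length ys \<and> set G \<subseteq> B
       \<and> (\<forall>i<length ys. \<forall>j<length ys. i \<noteq> j \<longrightarrow> (\<exists>v. G ! \<tau> v i \<noteq> G ! \<tau> v j))
       \<and> (\<forall>p\<in>F. \<forall>i<length ys. \<exists>v\<in>dom p. p v \<noteq> Some (G ! \<tau> v i)))"
    (is "_ \<longleftrightarrow> (\<exists>G. ?P G)")
proof -
  have Yball: "(\<forall>y\<in>Y. T y) \<longleftrightarrow> (\<forall>i<length ys. T (ys ! i))" for T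
    using ys(1) by (metis in_set_conv_nth)
  have main: "((\<forall>y\<in>Y. g y \<in> B)
       \<and> (\<forall>y\<in>Y. \<forall>z\<in>Y. y \<noteq> z \<longrightarrow> (\<exists>v. g (shift v y) \<noteq> g (shift v z)))
       \<and> (\<forall>p\<in>F. \<forall>y\<in>Y. \<exists>v\<in>dom p. p v \<noteq> Some (g (shift v y)))) \<longleftrightarrow> ?P G" (is "?Q g \<longleftrightarrow> _")
    if len: "length G = length ys" and G: "\<And>i. i < length ys \<Longrightarrow> g (ys ! i) = G ! i" for g G
  proof -
    have g: "g (shift v (ys ! i)) = G ! \<tau> v i" if "i < length ys" for v i
      using \<tau>[OF that, of v] G by metis
    have "set G \<subseteq> B \<longleftrightarrow> (\<forall>i<length ys. G ! i \<in> B)"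
      using len by (auto simp: set_conv_nth)
    then show ?thesis
      unfolding Yball using len ys(2) by (simp add: g G nth_eq_iff_index_eq cong: conj_cong)
  qed
  show ?thesis
    unfolding embeds_SFT_iff_block_map[OF Y]
  proof
    assume "\<exists>g. ?Q g"
    then obtain g where "?Q g" by blast
    then have "?P (map g ys)" by (subst (asm) main[of "map g ys"]) auto
    then show "\<exists>G. ?P G" by blast
  next
    assume "\<exists>G. ?P G"
    then obtain G where G: "?P G" by blast
    define g where "g y = G ! inv_into {..<length ys} ((!) ys) y" for y
    have "g (ys ! i) = G ! i" if "i < length ys" for i
      using that ys(2) by (simp add: g_def inv_into_f_f inj_on_nth)
    with G have "?Q g" by (subst main[of G]) auto
    then show "\<exists>g. ?Q g" by blast
  qed
qed

text \<open>With distinct keys no entry of the association list is shadowed by an earlier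
  one.\<close>

lemma ex_map_of_neq_iff:
  assumes "distinct (map fst p)"
  shows "(\<exists>v\<in>dom (map_of p). map_of p v \<noteq> Some (f v)) \<longleftrightarrow> (\<exists>x\<in>set p. f (fst x) \<noteq> snd x)"
proof
  assume "\<exists>v\<in>dom (map_of p). map_of p v \<noteq> Some (f v)"
  then obtain v a where "map_of p v = Some a" "f v \<noteq> a" by blast
  then show "\<exists>x\<in>set p. f (fst x) \<noteq> snd x"
    by (intro bexI[of _ "(v, a)"] map_of_SomeD) simp_all
next
  assume "\<exists>x\<in>set p. f (fst x) \<noteq> snd x"
  then obtain x where x: "x \<in> set p" "f (fst x) \<noteq> snd x" by blast
  then have "map_of p (fst x) = Some (snd x)" using assms by simp
  with x(2) show "\<exists>v\<in>dom (map_of p). map_of p v \<noteq> Some (f v)"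
    by (intro bexI[of _ "fst x"] domI) simp_all
qed

theorem proposition5p3:
  fixes A :: "'a set" and Y :: "('d::finite, 'a) config set"
  assumes "finite A" and "subshift A Y" and "finite Y"
  shows "decidable (embedding_problem A Y)"
proof -
  obtain ys where ys: "set ys = Y" "distinct ys"
    using finite_distinct_list[OF \<open>finite Y\<close>] by blast
  define k where "k = length ys"
  obtain \<tau> where comp_\<tau>: "computable (\<lambda>z. \<tau> (pfst z) (psnd z))"
    and \<tau>: "\<And>v :: int ^ 'd. \<And>i. i < k \<Longrightarrow>
      \<tau> (position_code v) i < k \<and> ys ! \<tau> (position_code v) i = shift v (ys ! i)"
    using shift_table[OF assms(2,3) ys(1)] unfolding k_def by metis
  \<comment> \<open>The index pairs reached from \<open>(i, j)\<close> by a common shift. The search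
    for a separating \<open>v\<close> in an infinite group becomes a search in this finite
    set.\<close>
  define D where "D i j =
    range (\<lambda>v :: int ^ 'd. prod_encode (\<tau> (position_code v) i, \<tau> (position_code v) j))" for i j
  have fin_D: "finite (D i j)" if "i < k" "j < k" for i j
    by (rule finite_subset[of _ "prod_encode ` ({..<k} \<times> {..<k})"]) (use \<tau> that in \<open>auto simp: D_def\<close>)
  \<comment> \<open>\<open>W\<close> depends on \<open>Y\<close> alone, so it enters the procedure
    as a constant: the list of all \<open>D i j\<close> with \<open>i \<noteq> j\<close>.\<close>
  define W where "W = list_encode (map (\<lambda>(i, j). list_encode (sorted_list_of_set (D i j)))
    (filter (\<lambda>(i, j). i \<noteq> j) (List.product [0..<k] [0..<k])))"
  \<comment> \<open>The candidate block map has code \<open>w\<close>. The first conjunct tests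
    injectivity, the second the forbidden patterns at the origin of each image.\<close>
  define P where "P w e \<longleftrightarrow>
    (\<forall>c\<in>set (list_decode W). \<exists>z\<in>set (list_decode c). \<not> code_nth w (pfst z) = code_nth w (psnd z)) \<and>
    (\<forall>p\<in>set (list_decode (psnd e)). \<forall>i\<in>set (list_decode (list_encode [0..<k])).
      \<exists>x\<in>set (list_decode p). \<not> code_nth w (\<tau> (pfst x) i) = psnd x)" for w e
  define E where "E e \<longleftrightarrow> (\<exists>G. length G = k \<and> set G \<subseteq> set (list_decode (pfst e)) \<and> P (list_encode G) e)" for e

  have P_iff: "P (list_encode G) (input_code I) \<longleftrightarrow>
      (\<forall>i<k. \<forall>j<k. i \<noteq> j \<longrightarrow> (\<exists>v :: int ^ 'd. G ! \<tau> (position_code v) i \<noteq> G ! \<tau> (position_code v) j)) \<and>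
      (\<forall>p\<in>input_patterns I. \<forall>i<k. \<exists>v\<in>dom p. p v \<noteq> Some (G ! \<tau> (position_code v) i))"
    if valid: "valid_input I" and G: "length G = k" for I :: "'d sft_input" and G
  proof -
    have nth: "code_nth (list_encode G) (\<tau> (position_code v) i) = G ! \<tau> (position_code v) i"
      if "i < k" for v :: "int ^ 'd" and i
      using \<tau>[OF that] G by (simp add: code_nth_list_encode)
    have "(\<forall>c\<in>set (list_decode W). \<exists>z\<in>set (list_decode c).
          \<not> code_nth (list_encode G) (pfst z) = code_nth (list_encode G) (psnd z)) \<longleftrightarrow>
        (\<forall>i<k. \<forall>j<k. i \<noteq> j \<longrightarrow> (\<exists>z\<in>D i j.
          \<not> code_nth (list_encode G) (pfst z) = code_nth (list_encode G) (psnd z)))"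
      \<comment> \<open>Finiteness matters here: \<open>sorted_list_of_set\<close> lists exactly the
        elements of a finite set.\<close>
      using fin_D by (force simp: W_def)
    also have "\<dots> \<longleftrightarrow> (\<forall>i<k. \<forall>j<k. i \<noteq> j \<longrightarrow>
        (\<exists>v :: int ^ 'd. G ! \<tau> (position_code v) i \<noteq> G ! \<tau> (position_code v) j))"
      by (auto simp: D_def nth)
    finally have W: "(\<forall>c\<in>set (list_decode W). \<exists>z\<in>set (list_decode c).
          \<not> code_nth (list_encode G) (pfst z) = code_nth (list_encode G) (psnd z)) \<longleftrightarrow> \<dots>" .
    have pat: "(\<exists>x\<in>set (list_decode (pattern_code p)).
          \<not> code_nth (list_encode G) (\<tau> (pfst x) i) = psnd x) \<longleftrightarrow>
        (\<exists>v\<in>dom (map_of p). map_of p v \<noteq> Some (G ! \<tau> (position_code v) i))"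
      if "p \<in> set (snd I)" "i < k" for p i
    proof -
      have "distinct (map fst p)"
        using valid that(1) by (auto simp: valid_input_def)
      then show ?thesis
        using that(2) by (simp only: ex_map_of_neq_iff list_decode_pattern_code set_map
            bex_simps prod_encode_inverse fst_conv snd_conv nth)
    qed
    have "(\<forall>p\<in>set (list_decode (psnd (input_code I))). \<forall>i\<in>set (list_decode (list_encode [0..<k])).
          \<exists>x\<in>set (list_decode p). \<not> code_nth (list_encode G) (\<tau> (pfst x) i) = psnd x) \<longleftrightarrow>
        (\<forall>p\<in>set (snd I). \<forall>i<k. \<exists>x\<in>set (list_decode (pattern_code p)).
          \<not> code_nth (list_encode G) (\<tau> (pfst x) i) = psnd x)"
      by (simp add: input_code_def Ball_def[of "{0..<k}"])
    also have "\<dots> \<longleftrightarrow> (\<forall>p\<in>set (snd I). \<forall>i<k.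
        \<exists>v\<in>dom (map_of p). map_of p v \<noteq> Some (G ! \<tau> (position_code v) i))"
      by (intro ball_cong all_cong pat refl)
    also have "\<dots> \<longleftrightarrow> (\<forall>p\<in>input_patterns I. \<forall>i<k.
        \<exists>v\<in>dom p. p v \<noteq> Some (G ! \<tau> (position_code v) i))"
      by (simp only: input_patterns_def ball_simps)
    finally show ?thesis
      unfolding P_def by (intro conj_cong W)
  qed
  have E_iff: "E (input_code I) \<longleftrightarrow> embeds A Y (input_alphabet I) (input_SFT I)"
    if "valid_input I" for I :: "'d sft_input"
  proof -
    have "E (input_code I) \<longleftrightarrow> (\<exists>G. length G = k \<and> set G \<subseteq> input_alphabet I \<and> P (list_encode G) (input_code I))"
      by (simp add: E_def input_code_def input_alphabet_def)
    moreover have "embeds A Y (input_alphabet I) (input_SFT I) \<longleftrightarrow>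
        (\<exists>G. length G = k \<and> set G \<subseteq> input_alphabet I \<and>
          (\<forall>i<k. \<forall>j<k. i \<noteq> j \<longrightarrow>
            (\<exists>v :: int ^ 'd. G ! \<tau> (position_code v) i \<noteq> G ! \<tau> (position_code v) j)) \<and>
          (\<forall>p\<in>input_patterns I. \<forall>i<k. \<exists>v\<in>dom p. p v \<noteq> Some (G ! \<tau> (position_code v) i)))"
      unfolding input_SFT_def k_def
      by (rule embeds_SFT_iff_list[OF assms(2,3) ys \<tau>[unfolded k_def]])
    ultimately show ?thesis
      by (simp only: P_iff[OF that] cong: conj_cong)
  qed
  \<comment> \<open>\<open>E\<close> has been related to embeddings only on codes of valid inputs,
    so well-formedness is tested as well.\<close>
  have "n \<in> embedding_problem A Y \<longleftrightarrow> well_formed_code CARD('d) n \<and> E n" for n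
  proof
    assume "n \<in> embedding_problem A Y"
    then obtain I :: "'d sft_input" where "n = input_code I" "valid_input I"
      "embeds A Y (input_alphabet I) (input_SFT I)"
      unfolding embedding_problem_def by blast
    then show "well_formed_code CARD('d) n \<and> E n"
      by (simp only: well_formed_input_code E_iff simp_thms)
  next
    assume n: "well_formed_code CARD('d) n \<and> E n"
    then obtain I :: "'d sft_input" where I: "input_code I = n"
      using ex_input_code by blast
    then have "valid_input I"
      using n well_formed_input_code by blast
    then show "n \<in> embedding_problem A Y"
      unfolding embedding_problem_def using n I E_iff by blast
  qed
  moreover have "decidable_pred E"
  proof -
    have comp_\<tau>': "computable (\<lambda>e. \<tau> (f e) (g e))" if "computable f" "computable g" for f g
      using computable_comp[OF comp_\<tau>, of "\<lambda>e. prod_encode (f e, g e)"] that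
      by (simp add: computable_prod_encode)
    have "decidable_pred (\<lambda>z. P (pfst z) (psnd z))"
      unfolding P_def
      by (intro decidable_pred_conj decidable_pred_list_all decidable_pred_list_ex
          decidable_pred_not decidable_pred_eq computable_code_nth comp_\<tau>' computable_const
          computable_pfst computable_psnd computable_id)
    from decidable_pred_ex_list[OF this, of "\<lambda>e. pfst e" k]
    have "decidable_pred (\<lambda>z. \<exists>G. length G = k \<and> set G \<subseteq> set (list_decode (pfst (psnd z)))
        \<and> P (list_encode (G @ list_decode (pfst z))) (psnd z))"
      by (simp add: computable_pfst computable_id)
    \<comment> \<open>The search starts from the empty suffix, whose code is 0.\<close>
    from computable_comp[OF this[unfolded decidable_pred_def], of "\<lambda>e. prod_encode (0, e)"]
    show ?thesis
      by (simp add: decidable_pred_def E_def computable_prod_encode computable_const computable_id)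
  qed
  ultimately show ?thesis
    by (simp add: decidable_iff_decidable_pred decidable_pred_conj decidable_pred_well_formed_code)
qed

end
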